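(* Let $T$ be a finite symmetric triangulation of $\mathbb{S}^2$ and let $\ell$ be a generalized Tucker labelling of $T$ by $\{\pm 1\}$, with linear extension $L : \mathbb{S}^2 = |T| \to \mathbb{R}$. Then there exists a polygonal simple closed path $P \subset \mathbb{S}^2$ such that $A(P) = P$, where $A(x) = -x$ is the antipodal map, and $L(x) = 0$ for all $x \in P$.
   Context: A finite triangulation $T$ of $\mathbb{S}^2$ (a finite simplicial complex whose underlying space $|T|$ is identified with $\mathbb{S}^2$) is called symmetric if for each simplex $\sigma$ of $T$, $-\sigma$ (its image under the antipodal map $A(x)=-x$) is also a simplex of $T$; in particular $v$ is a vertex iff $-v$ is a vertex. A generalized Tucker labelling of a symmetric triangulation $T$ of $\mathbb{S}^2$ by $\{\pm1\}$ is a function $\ell$ from the vertex set of $T$ to $\{+1,-1\}$ with $\ell(-v) = -\ell(v)$ for every vertex $v$. Its linear extension $L : |T| = \mathbb{S}^2 \to \mathbb{R}$ is the simplicial map obtained by extending $\ell$ affinely (via barycentric coordinates) over each simplex of $T$. A polygonal path is one that is piecewise linear with respect to the affine structures of the triangles of $T$ (it need not lie in the 1-skeleton and may pass through interiors of triangles).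
   Formalization: Symmetric is taken to mean also that the antipodal map is affine on each simplex of T (in its barycentric coordinates); if −σ need only be a simplex as a set, reparametrizing one edge of an octahedron makes the zero set of L a non-symmetric hexagon and the claim fails. *)

theory Defs
  imports "HOL-Analysis.Analysis"
begin

definition affine_map_on :: "'a::real_vector set \<Rightarrow> ('a \<Rightarrow> 'b::real_vector) \<Rightarrow> bool" where
  "affine_map_on S f \<longleftrightarrow>
     (\<forall>x\<in>S. \<forall>y\<in>S. \<forall>u\<in>{0..1}.
        f ((1 - u) *\<^sub>R x + u *\<^sub>R y) = (1 - u) *\<^sub>R f x + u *\<^sub>R f y)"

text \<open>A triangulation of the 2-sphere is a geometric simplicial complex \<open>K\<close> (in a Euclidean space
  of any dimension) with a homeomorphism \<open>h\<close> identifying its underlying space with the sphere.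
  The simplices of the triangulation, as subsets of the sphere, are the images \<open>h ` \<sigma>\<close> with
  \<open>\<sigma> \<in> K\<close>; their affine structure is the one carried over by \<open>h\<close>.\<close>

definition sphere_triangulation :: "'a::euclidean_space set set \<Rightarrow> ('a \<Rightarrow> real^3) \<Rightarrow> bool" where
  "sphere_triangulation K h \<longleftrightarrow>
     simplicial_complex K \<and> (\<exists>k. homeomorphism (\<Union>K) (sphere 0 1) h k)"

definition vertices_of :: "'a::euclidean_space set set \<Rightarrow> ('a \<Rightarrow> real^3) \<Rightarrow> (real^3) set" where
  "vertices_of K h = h ` {p. {p} \<in> K}"

text \<open>That \<open>-\<sigma>\<close> is again a simplex is meant for simplices with their affine structure, so the
  antipodal map is affine on each simplex. If only the underlying sets were required to match,
  the extension of an odd labelling need not be odd: one could reparametrize \<open>h\<close> along a single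
  edge so that midpoints of antipodal edges are no longer antipodal.\<close>

definition symmetric_triangulation :: "'a::euclidean_space set set \<Rightarrow> ('a \<Rightarrow> real^3) \<Rightarrow> bool" where
  "symmetric_triangulation K h \<longleftrightarrow>
     sphere_triangulation K h \<and>
     (\<forall>\<sigma>\<in>K. (\<exists>\<tau>\<in>K. uminus ` (h ` \<sigma>) = h ` \<tau>) \<and>
             affine_map_on \<sigma> (\<lambda>x. inv_into (\<Union>K) h (- h x)))"

definition tucker_labelling ::
    "'a::euclidean_space set set \<Rightarrow> ('a \<Rightarrow> real^3) \<Rightarrow> (real^3 \<Rightarrow> real) \<Rightarrow> bool" where
  "tucker_labelling K h l \<longleftrightarrow>
     (\<forall>v\<in>vertices_of K h. l v \<in> {1, -1} \<and> l (- v) = - l v)"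

text \<open>\<open>C\<close> is the vertex set of a simplex containing the point, \<open>u\<close> its barycentric coordinates.
  The value does not depend on the chosen simplex: see \<open>linear_extension_eq\<close> below.\<close>

definition linear_extension ::
    "'a::euclidean_space set set \<Rightarrow> ('a \<Rightarrow> real^3) \<Rightarrow> (real^3 \<Rightarrow> real) \<Rightarrow> real^3 \<Rightarrow> real" where
  "linear_extension K h l x =
     (THE r. \<exists>C u. \<not> affine_dependent C \<and> convex hull C \<in> K \<and>
               (\<forall>c\<in>C. 0 \<le> u c) \<and> sum u C = 1 \<and>
               x = h (\<Sum>c\<in>C. u c *\<^sub>R c) \<and> r = (\<Sum>c\<in>C. u c * l (h c)))"

definition polygonal_path ::
    "'a::euclidean_space set set \<Rightarrow> ('a \<Rightarrow> real^3) \<Rightarrow> (real \<Rightarrow> real^3) \<Rightarrow> bool" where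
  "polygonal_path K h g \<longleftrightarrow>
     path g \<and>
     (\<exists>(n::nat) (t::nat \<Rightarrow> real).
        t 0 = 0 \<and> t n = 1 \<and>
        (\<forall>i<n. t i < t (Suc i) \<and>
           (\<exists>\<sigma>\<in>K. g ` {t i..t (Suc i)} \<subseteq> h ` \<sigma> \<and>
                   affine_map_on {t i..t (Suc i)} (\<lambda>s. inv_into (\<Union>K) h (g s)))))"

lemma barycentric_unique:
  fixes C :: "'a::real_vector set"
  assumes "finite C" "\<not> affine_dependent C" "sum u C = sum w C"
    and "(\<Sum>c\<in>C. u c *\<^sub>R c) = (\<Sum>c\<in>C. w c *\<^sub>R c)" "c \<in> C"
  shows "u c = w c"
proof (rule ccontr)
  assume "u c \<noteq> w c"
  then have "affine_dependent C"
    unfolding affine_dependent_explicit_finite[OF assms(1)] using assms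
    by (intro exI[of _ "\<lambda>c. u c - w c"])
       (auto simp: sum_subtractf scaleR_left_diff_distrib)
  with assms(2) show False by simp
qed

lemma barycentric_restrict:
  fixes C D :: "'a::euclidean_space set"
  assumes C: "\<not> affine_dependent C" "D \<subseteq> C" "sum u C = 1"
    and y: "(\<Sum>c\<in>C. u c *\<^sub>R c) \<in> convex hull D"
  obtains w where "\<And>c. c \<in> D \<Longrightarrow> w c = u c" "sum w D = 1"
    "(\<Sum>c\<in>D. w c *\<^sub>R c) = (\<Sum>c\<in>C. u c *\<^sub>R c)" "\<And>c. c \<in> C - D \<Longrightarrow> u c = 0"
proof -
  have fin: "finite C" using C(1) aff_independent_finite by blast
  then have finD: "finite D" using C(2) finite_subset by blast
  obtain w where w: "sum w D = 1" "(\<Sum>c\<in>D. w c *\<^sub>R c) = (\<Sum>c\<in>C. u c *\<^sub>R c)"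
    using y by (auto simp: convex_hull_finite[OF finD])
  define w' where "w' c = (if c \<in> D then w c else 0)" for c
  have s: "sum w' C = sum w D"
    unfolding w'_def using fin C(2) by (simp add: sum.If_cases Int_absorb1 Int_commute)
  have "(\<Sum>c\<in>C. w' c *\<^sub>R c) = (\<Sum>c\<in>C. if c \<in> D then w c *\<^sub>R c else 0)"
    by (rule sum.cong) (auto simp: w'_def)
  also have "\<dots> = (\<Sum>c\<in>D. w c *\<^sub>R c)"
    using fin C(2) by (simp add: sum.If_cases Int_absorb1 Int_commute)
  finally have e: "(\<Sum>c\<in>C. w' c *\<^sub>R c) = (\<Sum>c\<in>C. u c *\<^sub>R c)" using w(2) by simp
  have eq: "w' c = u c" if "c \<in> C" for c
    by (rule barycentric_unique[OF fin C(1) _ e that]) (simp add: s w C)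
  show thesis
  proof (rule that[of w])
    show "w c = u c" if "c \<in> D" for c using eq[of c] that C(2) by (auto simp: w'_def)
    show "u c = 0" if "c \<in> C - D" for c using eq[of c] that by (auto simp: w'_def)
  qed (use w in auto)
qed

lemma barycentric_sum_well_defined:
  fixes C D :: "'a::euclidean_space set"
  assumes K: "simplicial_complex K" and CK: "convex hull C \<in> K" and DK: "convex hull D \<in> K"
    and C: "\<not> affine_dependent C" "\<forall>c\<in>C. 0 \<le> u c" "sum u C = 1"
    and D: "\<not> affine_dependent D" "\<forall>c\<in>D. 0 \<le> w c" "sum w D = 1"
    and eq: "(\<Sum>c\<in>C. u c *\<^sub>R c) = (\<Sum>c\<in>D. w c *\<^sub>R c)"
  shows "(\<Sum>c\<in>C. u c * f c) = (\<Sum>c\<in>D. w c * (f c :: real))"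
proof -
  have fin: "finite C" "finite D" using C(1) D(1) aff_independent_finite by blast+
  let ?I = "convex hull C \<inter> convex hull D"
  have "?I face_of convex hull C" "?I face_of convex hull D"
    using K CK DK unfolding simplicial_complex_def by (blast, metis Int_commute)
  then obtain E F where E: "E \<subseteq> C" "?I = convex hull E" and F: "F \<subseteq> D" "?I = convex hull F"
    using C(1) D(1) by (metis face_of_convex_hull_affine_independent)
  have "\<not> affine_dependent E" "\<not> affine_dependent F"
    using E F C(1) D(1) affine_dependent_subset by blast+
  then have EF: "E = F"
    using E(2) F(2) extreme_point_of_convex_hull_affine_independent by (metis subsetI subset_antisym)
  have yC: "(\<Sum>c\<in>C. u c *\<^sub>R c) \<in> convex hull C"
    using C by (auto simp: convex_hull_finite[OF fin(1)])
  have "(\<Sum>c\<in>D. w c *\<^sub>R c) \<in> convex hull D"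
    using D by (auto simp: convex_hull_finite[OF fin(2)])
  with yC eq have y: "(\<Sum>c\<in>C. u c *\<^sub>R c) \<in> convex hull E" "(\<Sum>c\<in>D. w c *\<^sub>R c) \<in> convex hull F"
    using E(2) F(2) by auto
  obtain u' where u': "\<And>c. c \<in> E \<Longrightarrow> u' c = u c" "sum u' E = 1"
    "(\<Sum>c\<in>E. u' c *\<^sub>R c) = (\<Sum>c\<in>C. u c *\<^sub>R c)" "\<And>c. c \<in> C - E \<Longrightarrow> u c = 0"
    using barycentric_restrict[OF C(1) E(1) C(3) y(1)] by blast
  obtain w' where w': "\<And>c. c \<in> F \<Longrightarrow> w' c = w c" "sum w' F = 1"
    "(\<Sum>c\<in>F. w' c *\<^sub>R c) = (\<Sum>c\<in>D. w c *\<^sub>R c)" "\<And>c. c \<in> D - F \<Longrightarrow> w c = 0"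
    using barycentric_restrict[OF D(1) F(1) D(3) y(2)] by blast
  have finE: "finite E" using E fin finite_subset by blast
  have same: "u' c = w' c" if "c \<in> E" for c
    by (rule barycentric_unique[OF finE \<open>\<not> affine_dependent E\<close> _ _ that])
       (use u' w' EF eq in auto)
  have "(\<Sum>c\<in>C. u c * f c) = (\<Sum>c\<in>E. u c * f c)"
    by (rule sum.mono_neutral_right) (use fin E u' in auto)
  also have "\<dots> = (\<Sum>c\<in>E. w c * f c)"
    by (rule sum.cong) (use same u'(1) w'(1) EF in auto)
  also have "\<dots> = (\<Sum>c\<in>D. w c * f c)"
    by (rule sum.mono_neutral_left) (use fin F w' EF in auto)
  finally show ?thesis .
qed

lemma linear_extension_eq:
  assumes T: "sphere_triangulation K h"
    and C: "\<not> affine_dependent C" "convex hull C \<in> K" "\<forall>c\<in>C. 0 \<le> u c" "sum u C = 1"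
  shows "linear_extension K h l (h (\<Sum>c\<in>C. u c *\<^sub>R c)) = (\<Sum>c\<in>C. u c * l (h c))"
  unfolding linear_extension_def
proof (rule the_equality)
  fix r
  assume "\<exists>D w. \<not> affine_dependent D \<and> convex hull D \<in> K \<and>
    (\<forall>c\<in>D. 0 \<le> w c) \<and> sum w D = 1 \<and>
    h (\<Sum>c\<in>C. u c *\<^sub>R c) = h (\<Sum>c\<in>D. w c *\<^sub>R c) \<and> r = (\<Sum>c\<in>D. w c * l (h c))"
  then obtain D w where D: "\<not> affine_dependent D" "convex hull D \<in> K" "\<forall>c\<in>D. 0 \<le> w c" "sum w D = 1"
    and heq: "h (\<Sum>c\<in>C. u c *\<^sub>R c) = h (\<Sum>c\<in>D. w c *\<^sub>R c)" and r: "r = (\<Sum>c\<in>D. w c * l (h c))"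
    by blast
  have inj: "inj_on h (\<Union>K)"
    using T unfolding sphere_triangulation_def homeomorphism_def by (metis inj_on_inverseI)
  have "(\<Sum>c\<in>C. u c *\<^sub>R c) \<in> convex hull C" "(\<Sum>c\<in>D. w c *\<^sub>R c) \<in> convex hull D"
    using C D by (auto simp: convex_hull_finite aff_independent_finite)
  then have "(\<Sum>c\<in>C. u c *\<^sub>R c) = (\<Sum>c\<in>D. w c *\<^sub>R c)"
    using inj_onD[OF inj heq] C(2) D(2) by blast
  then show "r = (\<Sum>c\<in>C. u c * l (h c))"
    unfolding r
    using barycentric_sum_well_defined[of K C D u w "\<lambda>c. l (h c)"] T C D
    by (simp add: sphere_triangulation_def)
qed (use C in blast)

end

theory Submission
  imports Defs
begin

text \<open>
  Carry the antipodal map over to the complex as a free involution \<open>a\<close> that is affine on simplices,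
  and call two zeros of \<open>L\<close> adjacent if they lie in a common simplex. By the Borsuk--Ulam theorem
  some zero is joined to its antipode by a chain of adjacent zeros. Among all such chains take a
  shortest one; continued by its antipode it is a cycle without chords. Since the intersection of
  two simplices is a face of both, segments of the cycle can only meet in the obvious end points,
  so the cycle is a simple closed polygon, and \<open>L\<close> vanishes on it because it is affine on simplices.
\<close>

subsection \<open>Odd maps on the sphere\<close>

text \<open>This is Borsuk-Ulam for maps into the plane. A nowhere zero \<open>F\<close> would have
  a continuous logarithm \<open>G\<close>. Oddness of \<open>F\<close> makes
  \<open>exp (G (- x) - G x) = - 1\<close>, so this difference is a constant; being odd itself, it
  is 0, and \<open>exp 0\<close> is not \<open>- 1\<close>.\<close>

lemma odd_map_sphere_has_zero:
  fixes F :: "'a::euclidean_space \<Rightarrow> complex"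
  assumes dim: "3 \<le> DIM('a)" and cont: "continuous_on (sphere 0 1) F"
    and odd: "\<And>x. x \<in> sphere 0 1 \<Longrightarrow> F (- x) = - F x"
  shows "\<exists>x\<in>sphere 0 1. F x = 0"
proof (rule ccontr)
  let ?S = "sphere (0::'a) 1"
  assume "\<not> (\<exists>x\<in>?S. F x = 0)"
  then have "F \<in> ?S \<rightarrow> - {0}" by auto
  with Borsukian_sphere[OF dim] cont obtain G
    where G: "continuous_on ?S G" "\<And>x. x \<in> ?S \<Longrightarrow> F x = exp (G x)"
    unfolding Borsukian_continuous_logarithm by metis
  define d where "d x = G (- x) - G x" for x
  have neg: "- x \<in> ?S" if "x \<in> ?S" for x using that by simp
  have contd: "continuous_on ?S d"
    unfolding d_def using neg
    by (intro continuous_intros continuous_on_compose2[OF G(1)] G(1)) auto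
  have expd: "exp (d x) = - 1" if "x \<in> ?S" for x
    using G(2)[OF that] G(2)[OF neg[OF that]] odd[OF that]
    by (auto simp: d_def exp_diff divide_eq_eq)
  \<comment> \<open>Any two logarithms of -1 differ by a multiple of \<open>2 * pi * \<i>\<close>,
    so \<open>d\<close> has discrete range and is constant on the connected sphere.\<close>
  have disc: "\<exists>e>0. \<forall>y. y \<in> ?S \<and> d y \<noteq> d x \<longrightarrow> e \<le> norm (d y - d x)" if "x \<in> ?S" for x
  proof (intro exI[of _ "2 * pi"] conjI allI impI)
    fix y assume y: "y \<in> ?S \<and> d y \<noteq> d x"
    then have "exp (d y) = exp (d x)" using expd that by simp
    then obtain m :: int where m: "d y = d x + of_int (2 * m) * pi * \<i>" by (auto simp: exp_eq)
    with y have "m \<noteq> 0" by auto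
    then have "1 \<le> \<bar>real_of_int m\<bar>" by linarith
    then have "2 * pi * 1 \<le> 2 * pi * \<bar>real_of_int m\<bar>" by (intro mult_left_mono) auto
    then show "2 * pi \<le> norm (d y - d x)" using m by (simp add: norm_mult mult_ac)
  qed simp
  have "connected ?S" by (rule connected_sphere) (use dim in simp)
  then have "d constant_on ?S"
    using continuous_discrete_range_constant[OF _ contd] disc by blast
  then obtain c where c: "\<And>x. x \<in> ?S \<Longrightarrow> d x = c" unfolding constant_on_def by blast
  obtain x where x: "x \<in> ?S" using vector_choose_size[of 1] by (auto simp: sphere_def)
  have "d (- x) = - d x" by (simp add: d_def)
  with c[OF x] c[OF neg[OF x]] have "c = 0" by (simp add: equation_minus_iff)
  with expd[OF x] c[OF x] show False by simp
qed

subsection \<open>Affine maps on simplices\<close>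

lemma affine_map_onD:
  assumes "affine_map_on S f" "x \<in> S" "y \<in> S" "0 \<le> u" "u \<le> 1"
  shows "f ((1 - u) *\<^sub>R x + u *\<^sub>R y) = (1 - u) *\<^sub>R f x + u *\<^sub>R f y"
  using assms(1)[unfolded affine_map_on_def, rule_format, OF assms(2,3), of u] assms(4,5) by simp

lemma affine_map_on_compose:
  assumes f: "affine_map_on S f" and g: "affine_map_on T g" and "f ` S \<subseteq> T"
  shows "affine_map_on S (\<lambda>x. g (f x))"
  unfolding affine_map_on_def
proof (intro ballI)
  fix x y and u :: real assume *: "x \<in> S" "y \<in> S" "u \<in> {0..1}"
  then have "f x \<in> T" "f y \<in> T" using assms(3) by auto
  then show "g (f ((1 - u) *\<^sub>R x + u *\<^sub>R y)) = (1 - u) *\<^sub>R g (f x) + u *\<^sub>R g (f y)"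
    using affine_map_onD[OF f, of x y u] affine_map_onD[OF g, of "f x" "f y" u] * by simp
qed

lemma affine_map_on_uminus:
  assumes "affine_map_on S f"
  shows "affine_map_on S (\<lambda>x. - f x)"
  unfolding affine_map_on_def
proof (intro ballI)
  fix x y and u :: real assume "x \<in> S" "y \<in> S" "u \<in> {0..1}"
  then show "- f ((1 - u) *\<^sub>R x + u *\<^sub>R y) = (1 - u) *\<^sub>R - f x + u *\<^sub>R - f y"
    using affine_map_onD[OF assms, of x y u] by simp
qed

lemma affine_map_on_linear:
  assumes "linear g"
  shows "affine_map_on S (\<lambda>x. b + g (x - p))"
  unfolding affine_map_on_def
proof (intro ballI)
  fix x y and u :: real
  have "(1 - u) *\<^sub>R x + u *\<^sub>R y - p = (1 - u) *\<^sub>R (x - p) + u *\<^sub>R (y - p)"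
    by (simp add: algebra_simps)
  then show "b + g ((1 - u) *\<^sub>R x + u *\<^sub>R y - p) =
      (1 - u) *\<^sub>R (b + g (x - p)) + u *\<^sub>R (b + g (y - p))"
    by (simp add: linear_add[OF assms] linear_scale[OF assms]) (simp add: algebra_simps)
qed

text \<open>The points of the hull where the two maps agree form a convex set containing
  \<open>C\<close>.\<close>

lemma affine_map_on_convex_hull_eq:
  assumes f: "affine_map_on (convex hull C) f" and g: "affine_map_on (convex hull C) g"
    and eq: "\<And>c. c \<in> C \<Longrightarrow> f c = g c" and x: "x \<in> convex hull C"
  shows "f x = g x"
proof -
  let ?E = "{x \<in> convex hull C. f x = g x}"
  have "convex ?E"
    unfolding convex_alt[of ?E]
  proof (intro ballI allI impI)
    fix x y and u :: real
    assume xy: "x \<in> ?E" "y \<in> ?E" and u: "0 \<le> u \<and> u \<le> 1"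
    then have "(1 - u) *\<^sub>R x + u *\<^sub>R y \<in> convex hull C"
      using convexD_alt[OF convex_convex_hull, of x C y u] by simp
    then show "(1 - u) *\<^sub>R x + u *\<^sub>R y \<in> ?E"
      using affine_map_onD[OF f, of x y u] affine_map_onD[OF g, of x y u] xy u by simp
  qed
  moreover have "C \<subseteq> ?E" using eq hull_inc by fastforce
  ultimately have "convex hull C \<subseteq> ?E" by (rule hull_minimal[rotated])
  with x show ?thesis by blast
qed

text \<open>Differences of affinely independent vertices from a base vertex \<open>p\<close> are
  linearly independent. Hence the vertex values of \<open>f\<close> extend to an affine map of the
  whole space, which is continuous and equals \<open>f\<close> on the simplex.\<close>

lemma affine_map_on_simplex_continuous:
  fixes f :: "'a::euclidean_space \<Rightarrow> real"
  assumes C: "\<not> affine_dependent C" and f: "affine_map_on (convex hull C) f"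
  shows "continuous_on (convex hull C) f"
proof (cases "C = {}")
  case False
  then obtain p where p: "p \<in> C" by blast
  have "independent {x - p |x. x \<in> C - {p}}"
    using dependent_imp_affine_dependent[of p "C - {p}"] C p by (auto simp: insert_absorb)
  from linear_independent_extend[OF this, of "\<lambda>x. f (x + p) - f p"]
  obtain g where g: "linear g" "\<forall>x\<in>{x - p |x. x \<in> C - {p}}. g x = f (x + p) - f p"
    by (elim exE conjE)
  have "f c = f p + g (c - p)" if "c \<in> C" for c
  proof (cases "c = p")
    case True
    then show ?thesis using linear_0[OF g(1)] by simp
  next
    case False
    then have "c - p \<in> {x - p |x. x \<in> C - {p}}" using that by blast
    with g(2) show ?thesis by auto
  qed
  then have eq: "f x = f p + g (x - p)" if "x \<in> convex hull C" for x
    using affine_map_on_convex_hull_eq[OF f affine_map_on_linear[OF g(1)] _ that] by blast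
  have "continuous_on (convex hull C) (\<lambda>x. f p + g (x - p))"
    by (intro continuous_intros linear_continuous_on_compose[OF _ g(1)])
  then show ?thesis by (rule continuous_on_eq) (simp add: eq)
qed simp

lemma simplicial_complex_simplex_cases:
  assumes "simplicial_complex K" "\<sigma> \<in> K"
  obtains C where "\<not> affine_dependent C" "\<sigma> = convex hull C" "\<And>c. c \<in> C \<Longrightarrow> {c} \<in> K"
proof -
  obtain n where "n simplex \<sigma>" using assms unfolding simplicial_complex_def by blast
  then obtain C where C: "\<not> affine_dependent C" "\<sigma> = convex hull C" unfolding simplex_def by blast
  have "{c} \<in> K" if "c \<in> C" for c
  proof -
    have "{c} face_of \<sigma>"
      using C that extreme_point_of_convex_hull_affine_independent face_of_singleton by metis
    then show ?thesis using assms unfolding simplicial_complex_def by blast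
  qed
  with C that show thesis by blast
qed

lemma simplicial_complex_simplex_properties:
  assumes "simplicial_complex K" "\<sigma> \<in> K"
  shows "convex \<sigma>" "compact \<sigma>"
proof -
  obtain C where "\<not> affine_dependent C" "\<sigma> = convex hull C"
    by (rule simplicial_complex_simplex_cases[OF assms])
  then show "convex \<sigma>" "compact \<sigma>"
    by (auto intro: aff_independent_finite compact_convex_hull finite_imp_compact)
qed

text \<open>The intersection of two simplices is a face of the first, and a face contains both ends
  of any segment of the simplex whose interior it meets.\<close>

lemma open_segment_meets_simplex:
  assumes K: "simplicial_complex K" and "\<sigma> \<in> K" "\<tau> \<in> K" "x \<in> \<sigma>" "y \<in> \<sigma>"
    and z: "z \<in> open_segment x y" "z \<in> \<tau>"
  shows "x \<in> \<tau>" "y \<in> \<tau>"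
proof -
  have face: "\<sigma> \<inter> \<tau> face_of \<sigma>" using assms unfolding simplicial_complex_def by blast
  have "convex \<sigma>" using simplicial_complex_simplex_properties(1) K \<open>\<sigma> \<in> K\<close> by blast
  then have "z \<in> \<sigma>"
    using assms convex_contains_open_segment by blast
  then show "x \<in> \<tau>" "y \<in> \<tau>" using face_ofD[OF face z(1)] assms by auto
qed

subsection \<open>A shortest chain between antipodal points\<close>

text \<open>In the application \<open>Z\<close> is the zero set, which meets every simplex in a
  convex set. Adjacent points are then joined by a straight segment of zeros, and chains are
  polygonal paths of zeros.\<close>

definition adj :: "'a set set \<Rightarrow> 'a set \<Rightarrow> 'a rel" where
  "adj K Z = {(x, y). x \<in> Z \<and> y \<in> Z \<and> (\<exists>\<sigma>\<in>K. x \<in> \<sigma> \<and> y \<in> \<sigma>)}"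

text \<open>\<open>a\<close> stands for the antipodal map transported to the complex.\<close>

locale free_simplicial_involution =
  fixes K :: "'a::euclidean_space set set" and a :: "'a \<Rightarrow> 'a"
  assumes complex: "simplicial_complex K"
    and simplex: "\<sigma> \<in> K \<Longrightarrow> a ` \<sigma> \<in> K"
    and affine: "\<sigma> \<in> K \<Longrightarrow> affine_map_on \<sigma> a"
    and invol: "x \<in> \<Union>K \<Longrightarrow> a (a x) = x"
    and free: "x \<in> \<Union>K \<Longrightarrow> a x \<noteq> x"
begin

lemma adj_image:
  assumes "a ` Z \<subseteq> Z" "(x, y) \<in> adj K Z"
  shows "(a x, a y) \<in> adj K Z"
proof -
  obtain \<sigma> where "\<sigma> \<in> K" "x \<in> \<sigma>" "y \<in> \<sigma>" "x \<in> Z" "y \<in> Z" using assms(2) by (auto simp: adj_def)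
  then have *: "a ` \<sigma> \<in> K" "a x \<in> a ` \<sigma>" "a y \<in> a ` \<sigma>" "a x \<in> Z" "a y \<in> Z"
    using simplex assms(1) by auto
  then have "\<exists>\<tau>\<in>K. a x \<in> \<tau> \<and> a y \<in> \<tau>" by (intro bexI[of _ "a ` \<sigma>"] conjI)
  with * show ?thesis by (simp add: adj_def)
qed

text \<open>In a common simplex \<open>a\<close> would be affine on the segment from
  \<open>x\<close> to \<open>a x\<close> and swap its ends, hence fix the midpoint.\<close>

lemma not_adj_antipode: "(x, a x) \<notin> adj K Z"
proof
  assume "(x, a x) \<in> adj K Z"
  then obtain \<sigma> where \<sigma>: "\<sigma> \<in> K" "x \<in> \<sigma>" "a x \<in> \<sigma>" by (auto simp: adj_def)
  have "convex \<sigma>" using simplicial_complex_simplex_properties(1)[OF complex \<sigma>(1)] .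
  let ?m = "(1 - 1/2) *\<^sub>R x + (1/2) *\<^sub>R a x"
  have "?m \<in> \<sigma>" using \<open>convex \<sigma>\<close>[unfolded convex_alt, rule_format, of x "a x" "1/2"] \<sigma> by simp
  moreover have "a ?m = ?m"
    using affine_map_onD[OF affine[OF \<sigma>(1)] \<sigma>(2,3), of "1/2"] invol[of x] \<sigma> by (auto simp: add.commute)
  ultimately show False using free \<sigma>(1) by blast
qed

text \<open>A chord of the cycle would shortcut the walk from one of its end points to the antipode of that
  end point, contradicting minimality.\<close>

lemma induced_antipodal_cycle:
  assumes Z: "Z \<subseteq> \<Union>K" "a ` Z \<subseteq> Z" and chain: "x \<in> Z" "(x, a x) \<in> (adj K Z)\<^sup>*"
  obtains n and q :: "nat \<Rightarrow> 'a" where "2 \<le> n" "\<And>k. q (k + n) = a (q k)"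
    "\<And>k. (q k, q (Suc k)) \<in> adj K Z"
    "\<And>i j. \<lbrakk>i \<le> j; j \<le> i + n; (q i, q j) \<in> adj K Z\<rbrakk> \<Longrightarrow> j \<le> Suc i"
proof -
  let ?R = "adj K Z"
  let ?P = "\<lambda>n. \<exists>x\<in>Z. (x, a x) \<in> ?R ^^ n"
  \<comment> \<open>The minimum is over all starting points in \<open>Z\<close>, because it is
    applied below to walks starting at an arbitrary \<open>q i\<close>.\<close>
  define n where "n = (LEAST n. ?P n)"
  have "\<exists>n. ?P n" using chain rtrancl_imp_relpow by fast
  then have "?P n" unfolding n_def by (rule LeastI_ex)
  then obtain x p where x: "x \<in> Z" and p: "p 0 = x" "p n = a x" "\<And>i. i < n \<Longrightarrow> (p i, p (Suc i)) \<in> ?R"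
    unfolding relpow_fun_conv by blast
  have minimal: "n \<le> m" if "y \<in> Z" "(y, a y) \<in> ?R ^^ m" for y m
    unfolding n_def using that by (intro Least_le) blast
  have n: "2 \<le> n"
  proof (rule ccontr)
    assume "\<not> 2 \<le> n"
    then have "n = 0 \<or> n = 1" by auto
    then show False
      using p(1,2) p(3)[of 0] not_adj_antipode[of x Z] free[OF subsetD[OF Z(1) x]] by auto
  qed
  \<comment> \<open>The shortest chain and its antipodal copy alternate in blocks of length
    \<open>n\<close>.\<close>
  define q where "q k = (if even (k div n) then p (k mod n) else a (p (k mod n)))" for k
  have pZ: "p i \<in> Z" if "i \<le> n" for i
    using p that Z x by (cases "i = n") (auto simp: adj_def)
  have qn: "q (k + n) = a (q k)" for k
    using n invol[OF subsetD[OF Z(1) pZ[of "k mod n"]]] by (simp add: q_def)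
  have edge: "(q k, q (Suc k)) \<in> ?R" for k
  proof -
    have lt: "k mod n < n" using n by simp
    \<comment> \<open>At the end of a block the pieces fit: \<open>p n = a (p 0)\<close> starts the
      antipodal copy, and \<open>a (p n) = p 0\<close> starts the chain again.\<close>
    have "q (Suc k) = (if even (k div n) then p (Suc (k mod n)) else a (p (Suc (k mod n))))"
    proof (cases "Suc (k mod n) = n")
      case True
      then have "Suc k mod n = 0" by (simp add: mod_Suc)
      moreover have "Suc k div n = Suc (k div n)" using True by (simp add: div_Suc mod_Suc)
      ultimately show ?thesis using True p(1,2) invol[OF subsetD[OF Z(1) x]] by (auto simp: q_def)
    next
      case False
      then show ?thesis by (simp add: q_def mod_Suc div_Suc)
    qed
    then show ?thesis using p(3)[OF lt] adj_image[OF Z(2) p(3)[OF lt]] by (simp add: q_def)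
  qed
  have walk: "(q i, q (i + m)) \<in> ?R ^^ m" for i m
    by (induction m) (auto intro: relcompI edge)
  have "j \<le> Suc i" if ij: "i \<le> j" "j \<le> i + n" "(q i, q j) \<in> ?R" for i j
  proof (rule ccontr)
    assume "\<not> j \<le> Suc i"
    \<comment> \<open>The chord followed by the walk from \<open>q j\<close> to
      \<open>q (i + n)\<close> reaches the antipode of \<open>q i\<close> in
      \<open>1 + i + n - j\<close> steps, fewer than \<open>n\<close> when \<open>j\<close> exceeds
      \<open>Suc i\<close>.\<close>
    have "(q j, a (q i)) \<in> ?R ^^ (i + n - j)" using walk[of j "i + n - j"] ij qn[of i] by simp
    then have "(q i, a (q i)) \<in> ?R ^^ Suc (i + n - j)" using ij(3) relpow_Suc_I2 by metis
    moreover have "q i \<in> Z" using ij(3) by (auto simp: adj_def)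
    ultimately have "n \<le> Suc (i + n - j)" using minimal by blast
    with \<open>\<not> j \<le> Suc i\<close> n ij show False by linarith
  qed
  with n qn edge that show thesis by blast
qed

end

section \<open>Chordless antipodal cycles and how their edges meet\<close>

locale antipodal_cycle = free_simplicial_involution K a
  for K :: "'a::euclidean_space set set" and a :: "'a \<Rightarrow> 'a" +
  fixes Z :: "'a set" and n :: nat and q :: "nat \<Rightarrow> 'a"
  assumes n: "2 \<le> n" and q_antipode: "q (k + n) = a (q k)"
    and edge: "(q k, q (Suc k)) \<in> adj K Z"
    and induced: "\<lbrakk>i \<le> j; j \<le> i + n; (q i, q j) \<in> adj K Z\<rbrakk> \<Longrightarrow> j \<le> Suc i"
begin

lemma no_chord: "(q i, q (Suc (Suc i))) \<notin> adj K Z"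
  using induced[of i "Suc (Suc i)"] n by auto

text \<open>If the two points coincided, the edge following \<open>q (Suc i)\<close> would be a
  chord starting at \<open>q i\<close>.\<close>

lemma q_Suc_neq: "q i \<noteq> q (Suc i)"
  using no_chord edge by metis

text \<open>A common point interior to one edge would put the ends of that edge into the simplex
  carrying the other edge, producing a chord. So the point is an end of both edges, and the absence
  of chords leaves only consecutive edges. The bound \<open>j \<le> i + n\<close> is no loss on a
  cycle of length \<open>2 * n\<close>, where one of two positions always follows the other within
  \<open>n\<close> steps.\<close>

lemma edges_meet:
  assumes ij: "i < j" "j \<le> i + n"
    and z: "z \<in> closed_segment (q i) (q (Suc i))" "z \<in> closed_segment (q j) (q (Suc j))"
  shows "j = Suc i \<and> z = q (Suc i)"
proof -
  let ?R = "adj K Z"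
  obtain \<sigma> where \<sigma>: "\<sigma> \<in> K" "q i \<in> \<sigma>" "q (Suc i) \<in> \<sigma>" "q i \<in> Z" "q (Suc i) \<in> Z"
    using edge[of i] by (auto simp: adj_def)
  obtain \<tau> where \<tau>: "\<tau> \<in> K" "q j \<in> \<tau>" "q (Suc j) \<in> \<tau>" "q j \<in> Z" "q (Suc j) \<in> Z"
    using edge[of j] by (auto simp: adj_def)
  have "convex \<sigma>" "convex \<tau>"
    using simplicial_complex_simplex_properties(1)[OF complex] \<sigma>(1) \<tau>(1) by blast+
  then have z\<sigma>\<tau>: "z \<in> \<sigma>" "z \<in> \<tau>"
    using z \<sigma> \<tau> closed_segment_subset by blast+
  \<comment> \<open>Adjacency of \<open>q i\<close> and \<open>q j\<close> forces
    \<open>j = Suc i\<close>, and then \<open>q i\<close> and \<open>q (Suc j)\<close> are two steps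
    apart in one simplex.\<close>
  have not_all: "\<not> (q i \<in> \<rho> \<and> q j \<in> \<rho> \<and> q (Suc j) \<in> \<rho>)" if "\<rho> \<in> K" for \<rho>
  proof
    assume all: "q i \<in> \<rho> \<and> q j \<in> \<rho> \<and> q (Suc j) \<in> \<rho>"
    then have "(q i, q j) \<in> ?R" using that \<sigma> \<tau> by (auto simp: adj_def)
    then have "j = Suc i" using induced[of i j] ij by auto
    with all that \<sigma> \<tau> no_chord[of i] show False by (auto simp: adj_def)
  qed
  have "z \<notin> open_segment (q i) (q (Suc i))"
    using open_segment_meets_simplex[OF complex \<sigma>(1) \<tau>(1) \<sigma>(2,3)] z\<sigma>\<tau> not_all[OF \<tau>(1)] \<tau> by blast
  then have zi: "z = q i \<or> z = q (Suc i)" using z(1) by (auto simp: open_segment_def)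
  have "z \<notin> open_segment (q j) (q (Suc j))"
    using open_segment_meets_simplex[OF complex \<tau>(1) \<sigma>(1) \<tau>(2,3)] z\<sigma>\<tau> not_all[OF \<sigma>(1)] \<sigma> by blast
  then have zj: "z = q j \<or> z = q (Suc j)" using z(2) by (auto simp: open_segment_def)
  have "z \<noteq> q i" using not_all[OF \<tau>(1)] \<tau> z\<sigma>\<tau> by blast
  with zi have zi: "z = q (Suc i)" by blast
  have "(q (Suc i), q j) \<in> ?R" "(q (Suc i), q (Suc j)) \<in> ?R"
    using zi z\<sigma>\<tau> \<sigma> \<tau> by (auto simp: adj_def)
  then have "Suc j \<le> Suc (Suc i)" using induced[of "Suc i" "Suc j"] ij by auto
  with ij zi show ?thesis by auto
qed

section \<open>The closed polygon as a parametrised curve\<close>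

definition loop :: "real \<Rightarrow> 'a" where
  "loop r = (1 - (r - real (nat \<lfloor>r\<rfloor>))) *\<^sub>R q (nat \<lfloor>r\<rfloor>) + (r - real (nat \<lfloor>r\<rfloor>)) *\<^sub>R q (Suc (nat \<lfloor>r\<rfloor>))"

text \<open>The formula includes the right end point, where the floor already selects the next edge:
  both edges give \<open>q (Suc i)\<close> there.\<close>

lemma loop_edge:
  assumes "real i \<le> r" "r \<le> real (Suc i)"
  shows "loop r = (1 - (r - real i)) *\<^sub>R q i + (r - real i) *\<^sub>R q (Suc i)"
proof (cases "r = real (Suc i)")
  case True
  then have "nat \<lfloor>r\<rfloor> = Suc i" by (metis floor_of_nat nat_int)
  with True show ?thesis by (simp add: loop_def)
next
  case False
  then have "nat \<lfloor>r\<rfloor> = i" using assms by (simp add: floor_eq4)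
  then show ?thesis by (simp add: loop_def)
qed

lemma floor_bounds:
  assumes "0 \<le> r"
  shows "real (nat \<lfloor>r\<rfloor>) \<le> r" "r < real (Suc (nat \<lfloor>r\<rfloor>))"
  using assms by linarith+

lemma loop_in_segment:
  assumes "real i \<le> r" "r \<le> real (Suc i)"
  shows "loop r \<in> closed_segment (q i) (q (Suc i))"
  unfolding loop_edge[OF assms] closed_segment_def
  using assms by (intro CollectI exI[of _ "r - real i"]) auto

lemma loop_affine: "affine_map_on {real i..real (Suc i)} loop"
  unfolding affine_map_on_def
proof (intro ballI)
  fix x y u :: real
  assume xyu: "x \<in> {real i..real (Suc i)}" "y \<in> {real i..real (Suc i)}" "u \<in> {0..1}"
  let ?r = "(1 - u) *\<^sub>R x + u *\<^sub>R y"
  have "?r \<in> {real i..real (Suc i)}"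
    using convex_real_interval(5)[of "real i" "real (Suc i)", unfolded convex_alt] xyu by auto
  then have eqs: "loop ?r = (1 - (?r - real i)) *\<^sub>R q i + (?r - real i) *\<^sub>R q (Suc i)"
      "loop x = (1 - (x - real i)) *\<^sub>R q i + (x - real i) *\<^sub>R q (Suc i)"
      "loop y = (1 - (y - real i)) *\<^sub>R q i + (y - real i) *\<^sub>R q (Suc i)"
    using xyu by (auto intro!: loop_edge)
  show "loop ?r = (1 - u) *\<^sub>R loop x + u *\<^sub>R loop y"
    unfolding eqs by (simp add: algebra_simps)
qed

text \<open>\<open>a\<close> is affine on a simplex carrying edge \<open>i\<close>, so it maps this
  edge to edge \<open>i + n\<close> with the same parameter.\<close>

lemma loop_antipode:
  assumes "0 \<le> r"
  shows "loop (r + real n) = a (loop r)"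
proof -
  define i where "i = nat \<lfloor>r\<rfloor>"
  have i: "real i \<le> r" "r \<le> real (Suc i)" unfolding i_def using floor_bounds[OF assms] by auto
  obtain \<sigma> where \<sigma>: "\<sigma> \<in> K" "q i \<in> \<sigma>" "q (Suc i) \<in> \<sigma>" using edge[of i] by (auto simp: adj_def)
  have "loop (r + real n) = (1 - (r - real i)) *\<^sub>R q (i + n) + (r - real i) *\<^sub>R q (Suc i + n)"
    using loop_edge[of "i + n" "r + real n"] i by simp
  also have "\<dots> = a (loop r)"
    unfolding q_antipode using affine_map_onD[OF affine[OF \<sigma>(1)] \<sigma>(2,3), of "r - real i"] i
    by (simp add: loop_edge[OF i])
  finally show ?thesis .
qed

lemma loop_in_common_simplex:
  assumes conv: "\<And>\<sigma>. \<sigma> \<in> K \<Longrightarrow> convex (Z \<inter> \<sigma>)"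
  obtains \<sigma> where "\<sigma> \<in> K" "loop ` {real i..real (Suc i)} \<subseteq> Z \<inter> \<sigma>"
proof -
  obtain \<sigma> where \<sigma>: "\<sigma> \<in> K" "q i \<in> Z \<inter> \<sigma>" "q (Suc i) \<in> Z \<inter> \<sigma>"
    using edge[of i] by (auto simp: adj_def)
  then have "closed_segment (q i) (q (Suc i)) \<subseteq> Z \<inter> \<sigma>" using closed_segment_subset conv by metis
  then have "loop ` {real i..real (Suc i)} \<subseteq> Z \<inter> \<sigma>" using loop_in_segment by fastforce
  with \<sigma> that show thesis by blast
qed

lemma loop_in_carrier:
  assumes "\<And>\<sigma>. \<sigma> \<in> K \<Longrightarrow> convex (Z \<inter> \<sigma>)" "0 \<le> r"
  shows "loop r \<in> Z \<inter> \<Union>K"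
proof -
  obtain \<sigma> where "\<sigma> \<in> K" "loop ` {real (nat \<lfloor>r\<rfloor>)..real (Suc (nat \<lfloor>r\<rfloor>))} \<subseteq> Z \<inter> \<sigma>"
    using loop_in_common_simplex[OF assms(1)] by metis
  moreover have "r \<in> {real (nat \<lfloor>r\<rfloor>)..real (Suc (nat \<lfloor>r\<rfloor>))}"
    using floor_bounds[OF assms(2)] by simp
  ultimately show ?thesis by blast
qed

lemma q_period: "q (k + 2 * n) = q k"
proof -
  have "q k \<in> \<Union>K" using edge[of k] by (auto simp: adj_def)
  then show ?thesis using q_antipode[of "k + n"] q_antipode[of k] invol by (simp add: mult_2 add.assoc)
qed

lemma loop_period:
  assumes "0 \<le> r"
  shows "loop (r + 2 * real n) = loop r"
proof -
  define i where "i = nat \<lfloor>r\<rfloor>"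
  have i: "real i \<le> r" "r \<le> real (Suc i)" unfolding i_def using floor_bounds[OF assms] by auto
  then show ?thesis
    using loop_edge[of "i + 2 * n" "r + 2 * real n"] loop_edge[OF i] q_period[of i] q_period[of "Suc i"]
    by simp
qed

lemma loop_inj:
  assumes rs: "0 \<le> r" "r < s" "s < 2 * real n"
  shows "loop r \<noteq> loop s"
proof
  assume eq: "loop r = loop s"
  define i j where "i = nat \<lfloor>r\<rfloor>" and "j = nat \<lfloor>s\<rfloor>"
  have i: "real i \<le> r" "r < real (Suc i)" unfolding i_def using floor_bounds[of r] rs by auto
  have j: "real j \<le> s" "s < real (Suc j)" unfolding j_def using floor_bounds[of s] rs by auto
  have zi: "loop r \<in> closed_segment (q i) (q (Suc i))" using loop_in_segment i by simp
  have zj: "loop r \<in> closed_segment (q j) (q (Suc j))" using loop_in_segment j eq by simp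
  \<comment> \<open>Edges can share only an end vertex, which is attained at the right end of the
    parameter interval; \<open>r\<close> and \<open>s\<close> lie strictly before the right ends of
    theirs.\<close>
  have end_only: "t = real (Suc k)"
    if "real k \<le> t" "t \<le> real (Suc k)" "loop t = q (Suc k)" for t k
  proof -
    have "(1 - (t - real k)) *\<^sub>R (q (Suc k) - q k) = 0"
      using that loop_edge[of k t] by (simp add: algebra_simps)
    then show ?thesis using q_Suc_neq[of k] by simp
  qed
  have "i \<le> j" using i j rs by linarith
  then consider "i = j" | "i < j" "j \<le> i + n" | "i + n < j" by linarith
  then show False
  proof cases
    case 1
    have "(s - r) *\<^sub>R (q (Suc i) - q i) = 0"
      using eq loop_edge[of i r] loop_edge[of i s] i j 1 by (simp add: algebra_simps)
    then show False using rs q_Suc_neq[of i] by simp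
  next
    case 2
    then show False using edges_meet[OF 2 zi zj] end_only[of i r] i by auto
  next
    case 3
    \<comment> \<open>Edges more than \<open>n\<close> apart are compared the other way round the
      cycle: edge \<open>i\<close> is also edge \<open>i + 2 * n\<close>, which follows
      \<open>j\<close> by less than \<open>n\<close>.\<close>
    have "j < 2 * n" using j(1) rs by linarith
    moreover have "loop r \<in> closed_segment (q (i + 2 * n)) (q (Suc (i + 2 * n)))"
      using zi q_period[of i] q_period[of "Suc i"] by simp
    ultimately have "loop r = q (Suc j)" using edges_meet[of j "i + 2 * n"] zj 3 by auto
    then show False using end_only[of j s] eq j by auto
  qed
qed

lemma loop_eq_iff:
  assumes "0 \<le> r" "r \<le> s" "s \<le> 2 * real n" "loop r = loop s"
  shows "r = s \<or> r = 0 \<and> s = 2 * real n"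
proof (cases "s = 2 * real n")
  case True
  then have "loop 0 = loop r" using loop_period[of 0] assms(4) by simp
  then show ?thesis using True loop_inj[of 0 r] assms by force
next
  case False
  then show ?thesis using loop_inj[of r s] assms by force
qed

lemma continuous_on_loop: "continuous_on {0..real m} loop"
proof (induction m)
  case (Suc m)
  have "continuous_on {real m..real (Suc m)} (\<lambda>r. (1 - (r - real m)) *\<^sub>R q m + (r - real m) *\<^sub>R q (Suc m))"
    by (intro continuous_intros)
  then have "continuous_on {real m..real (Suc m)} loop"
    by (rule continuous_on_eq) (use loop_edge in auto)
  then have "continuous_on ({0..real m} \<union> {real m..real (Suc m)}) loop"
    using Suc by (intro continuous_on_closed_Un) auto
  then show ?case by (simp add: ivl_disj_un_two_touch)
qed simp

end

subsection \<open>The zero set of an odd function\<close>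

text \<open>If no chain in the zero set joined antipodal points, then numbering the chain components and
  subtracting the number of the antipodal component would give an odd function without zeros on
  the zero set; paired with the given function it contradicts the Borsuk--Ulam theorem.\<close>

lemma (in free_simplicial_involution) zero_set_joins_antipodes:
  fixes h :: "'a \<Rightarrow> 'b::euclidean_space" and \<Lambda> :: "'a \<Rightarrow> real"
  assumes dim: "3 \<le> DIM('b)"
    and h: "homeomorphism (\<Union>K) (sphere 0 1) h k" "\<And>x. x \<in> \<Union>K \<Longrightarrow> h (a x) = - h x"
    and \<Lambda>: "continuous_on (\<Union>K) \<Lambda>" "\<And>x. x \<in> \<Union>K \<Longrightarrow> \<Lambda> (a x) = - \<Lambda> x"
  defines "Z \<equiv> {x \<in> \<Union>K. \<Lambda> x = 0}"
  shows "\<exists>x\<in>Z. (x, a x) \<in> (adj K Z)\<^sup>*"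
proof (rule ccontr)
  assume no: "\<not> ?thesis"
  have aK: "a x \<in> \<Union>K" if "x \<in> \<Union>K" for x using that simplex by blast
  have aZ: "a x \<in> Z" if "x \<in> Z" for x using that aK \<Lambda>(2) by (auto simp: Z_def)
  have ZK: "Z \<subseteq> \<Union>K" by (auto simp: Z_def)
  have closed_simplex: "closed \<sigma>" if "\<sigma> \<in> K" for \<sigma>
    using simplicial_complex_simplex_properties(2)[OF complex that] compact_imp_closed by blast
  have fin: "finite K" using complex by (simp add: simplicial_complex_def)
  then have "closed (\<Union>K)" using closed_simplex by blast
  then have closedZ: "closed Z"
    unfolding Z_def by (rule continuous_closed_preimage_constant[OF \<Lambda>(1)])
  \<comment> \<open>These are the chain components. All zeros in one simplex share a component, so
    there are finitely many and they can be numbered.\<close>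
  define cls where "cls x = (adj K Z)\<^sup>* `` {x}" for x
  have cls_eq: "cls x = cls y" if "x \<in> Z \<inter> \<sigma>" "y \<in> Z \<inter> \<sigma>" "\<sigma> \<in> K" for x y \<sigma>
  proof -
    have "(x, y) \<in> (adj K Z)\<^sup>*" "(y, x) \<in> (adj K Z)\<^sup>*" using that by (auto simp: adj_def)
    then show ?thesis unfolding cls_def by (auto intro: rtrancl_trans)
  qed
  have "finite (cls ` (Z \<inter> \<sigma>))" if "\<sigma> \<in> K" for \<sigma>
  proof (cases "Z \<inter> \<sigma> = {}")
    case False
    then obtain x where "x \<in> Z \<inter> \<sigma>" by blast
    then have "cls ` (Z \<inter> \<sigma>) \<subseteq> {cls x}" using cls_eq that by blast
    then show ?thesis using finite_subset by blast
  qed simp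
  then have "finite (\<Union>\<sigma>\<in>K. cls ` (Z \<inter> \<sigma>))" using fin by blast
  moreover have "cls ` Z \<subseteq> (\<Union>\<sigma>\<in>K. cls ` (Z \<inter> \<sigma>))" using ZK by blast
  ultimately have "finite (cls ` Z)" by (rule finite_subset[rotated])
  then obtain f :: "'a set \<Rightarrow> nat" where f: "inj_on f (cls ` Z)"
    using finite_imp_inj_to_nat_seg by metis
  define \<phi> where "\<phi> x = real (f (cls x)) - real (f (cls (a x)))" for x
  have \<phi>_nz: "\<phi> x \<noteq> 0" if "x \<in> Z" for x
  proof
    assume "\<phi> x = 0"
    then have "cls x = cls (a x)" using inj_onD[OF f, of "cls x" "cls (a x)"] aZ that by (simp add: \<phi>_def)
    then have "a x \<in> cls x" by (simp add: cls_def)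
    then show False using no that by (auto simp: cls_def)
  qed
  have \<phi>_odd: "\<phi> (a x) = - \<phi> x" if "x \<in> Z" for x
    using invol[OF subsetD[OF ZK that]] by (simp add: \<phi>_def)
  \<comment> \<open>\<open>\<phi>\<close> is constant on each of finitely many closed
    pieces.\<close>
  have "continuous_on (\<Union>\<sigma>\<in>K. Z \<inter> \<sigma>) \<phi>"
  proof (rule continuous_on_closed_Union[OF fin])
    fix \<sigma> assume \<sigma>: "\<sigma> \<in> K"
    show "closed (Z \<inter> \<sigma>)" using closedZ closed_simplex[OF \<sigma>] by blast
    have "\<phi> x = \<phi> y" if "x \<in> Z \<inter> \<sigma>" "y \<in> Z \<inter> \<sigma>" for x y
    proof -
      have "cls (a x) = cls (a y)"
        using cls_eq[of "a x" "a ` \<sigma>" "a y"] that aZ simplex[OF \<sigma>] by auto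
      then show ?thesis using cls_eq[OF that \<sigma>] by (simp add: \<phi>_def)
    qed
    then have "\<phi> constant_on Z \<inter> \<sigma>" unfolding constant_on_def by metis
    then show "continuous_on (Z \<inter> \<sigma>) \<phi>" unfolding constant_on_def
      using continuous_on_cong continuous_on_const by (metis (no_types, lifting))
  qed
  moreover have "(\<Union>\<sigma>\<in>K. Z \<inter> \<sigma>) = Z" using ZK by blast
  ultimately have cont\<phi>: "continuous_on Z \<phi>" by simp
  obtain \<Phi> where \<Phi>: "continuous_on (\<Union>K) \<Phi>" "\<And>x. x \<in> Z \<Longrightarrow> \<Phi> x = \<phi> x"
    using Tietze_unbounded[OF cont\<phi>, of "\<Union>K"] closed_subset[OF ZK closedZ] by blast
  let ?S = "sphere (0::'b) 1"
  have k: "continuous_on ?S k" "\<And>y. y \<in> ?S \<Longrightarrow> k y \<in> \<Union>K" "\<And>y. y \<in> ?S \<Longrightarrow> h (k y) = y"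
    "\<And>x. x \<in> \<Union>K \<Longrightarrow> k (h x) = x"
    using h(1) unfolding homeomorphism_def by auto
  have k_neg: "k (- y) = a (k y)" if "y \<in> ?S" for y
    using h(2)[OF k(2)[OF that]] k(3)[OF that] k(4)[OF aK[OF k(2)[OF that]]] by simp
  have ck: "continuous_on ?S (\<lambda>y. G (k y))" if "continuous_on (\<Union>K) G" for G :: "'a \<Rightarrow> real"
    using continuous_on_compose2[OF that k(1)] k(2) by blast
  have "continuous_on ?S (\<lambda>y. \<Phi> (k (- y)))"
    by (rule continuous_on_compose2[OF ck[OF \<Phi>(1)], of ?S uminus]) (auto intro: continuous_intros)
  \<comment> \<open>The Tietze extension \<open>\<Phi>\<close> need not be odd, so its odd part, up
    to a factor 2, is taken. At a zero of \<open>F\<close> the first component puts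
    \<open>k y\<close> into \<open>Z\<close>, where the second is twice the nonzero value of
    \<open>\<phi>\<close>.\<close>
  define F where "F y = Complex (\<Lambda> (k y)) (\<Phi> (k y) - \<Phi> (k (- y)))" for y
  have "continuous_on ?S F"
    unfolding F_def Complex_eq using ck[OF \<Phi>(1)] ck[OF \<Lambda>(1)] \<open>continuous_on ?S (\<lambda>y. \<Phi> (k (- y)))\<close>
    by (intro continuous_intros)
  moreover have "F (- y) = - F y" if "y \<in> ?S" for y
    using k_neg[OF that] \<Lambda>(2)[OF k(2)[OF that]] by (simp add: F_def complex_eq_iff)
  ultimately obtain y where y: "y \<in> ?S" "F y = 0"
    using odd_map_sphere_has_zero[OF dim, of F] by blast
  then have "k y \<in> Z" using k(2) by (simp add: F_def Z_def complex_eq_iff)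
  moreover have "\<Phi> (k y) - \<Phi> (a (k y)) = 0" using y k_neg by (simp add: F_def complex_eq_iff)
  ultimately show False using \<Phi>(2) \<phi>_odd \<phi>_nz aZ by fastforce
qed

subsection \<open>Linear extensions\<close>

lemma linear_extension_vertex:
  assumes "sphere_triangulation K h" "{c} \<in> K"
  shows "linear_extension K h l (h c) = l (h c)"
  using linear_extension_eq[OF assms(1), of "{c}" "\<lambda>_. 1" l] assms(2) by simp

text \<open>With respect to one vertex set, a convex combination of points has the same combination
  of their coordinates as barycentric coordinates.\<close>

lemma linear_extension_affine:
  assumes T: "sphere_triangulation K h" and \<sigma>: "\<sigma> \<in> K"
  shows "affine_map_on \<sigma> (\<lambda>x. linear_extension K h l (h x))"
  unfolding affine_map_on_def
proof (intro ballI)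
  fix x y and t :: real
  assume xy: "x \<in> \<sigma>" "y \<in> \<sigma>" and t: "t \<in> {0..1}"
  have "simplicial_complex K" using T by (simp add: sphere_triangulation_def)
  then obtain C where C: "\<not> affine_dependent C" "\<sigma> = convex hull C"
    by (rule simplicial_complex_simplex_cases[OF _ \<sigma>])
  have fin: "finite C" using C(1) aff_independent_finite by blast
  obtain u where u: "\<forall>c\<in>C. 0 \<le> u c" "sum u C = 1" "x = (\<Sum>c\<in>C. u c *\<^sub>R c)"
    using xy(1) C(2) convex_hull_finite[OF fin] by auto
  obtain w where w: "\<forall>c\<in>C. 0 \<le> w c" "sum w C = 1" "y = (\<Sum>c\<in>C. w c *\<^sub>R c)"
    using xy(2) C(2) convex_hull_finite[OF fin] by auto
  let ?v = "\<lambda>c. (1 - t) * u c + t * w c"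
  have v: "\<forall>c\<in>C. 0 \<le> ?v c" "sum ?v C = 1"
    using u w t by (auto simp: sum.distrib simp flip: sum_distrib_left)
  have "(1 - t) *\<^sub>R x + t *\<^sub>R y = (\<Sum>c\<in>C. ?v c *\<^sub>R c)"
    by (simp add: u w scaleR_add_left sum.distrib scaleR_sum_right)
  then show "linear_extension K h l (h ((1 - t) *\<^sub>R x + t *\<^sub>R y)) =
      (1 - t) *\<^sub>R linear_extension K h l (h x) + t *\<^sub>R linear_extension K h l (h y)"
    using linear_extension_eq[OF T C(1) _ v, of l] linear_extension_eq[OF T C(1) _ u(1,2), of l]
      linear_extension_eq[OF T C(1) _ w(1,2), of l] C(2) \<sigma> u(3) w(3)
    by (simp add: distrib_right sum.distrib sum_distrib_left mult.assoc)
qed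

section \<open>The symmetric polygon of zeros on the sphere\<close>

theorem theorem1p2:
  fixes K :: "'a::euclidean_space set set"
    and h :: "'a \<Rightarrow> real^3"
    and l :: "real^3 \<Rightarrow> real"
  assumes "symmetric_triangulation K h"
    and "tucker_labelling K h l"
  shows "\<exists>g. polygonal_path K h g \<and> simple_path g \<and> pathfinish g = pathstart g \<and>
             path_image g \<subseteq> sphere 0 1 \<and>
             uminus ` path_image g = path_image g \<and>
             (\<forall>x\<in>path_image g. linear_extension K h l x = 0)"
proof -
  let ?S = "sphere (0::real^3) 1"
  \<comment> \<open>The antipodal map and \<open>L\<close> are pulled back along \<open>h\<close>,
    so that the argument takes place in the geometric complex.\<close>
  define a where "a x = inv_into (\<Union>K) h (- h x)" for x
  define \<Lambda> where "\<Lambda> x = linear_extension K h l (h x)" for x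
  have T: "sphere_triangulation K h" using assms(1) by (simp add: symmetric_triangulation_def)
  then obtain k where K: "simplicial_complex K" and hk: "homeomorphism (\<Union>K) ?S h k"
    by (auto simp: sphere_triangulation_def)
  have h: "continuous_on (\<Union>K) h" "h ` \<Union>K = ?S" and inj: "inj_on h (\<Union>K)"
    using hk unfolding homeomorphism_def by (auto intro: inj_on_inverseI)
  have inv_h: "inv_into (\<Union>K) h (h x) = x" if "x \<in> \<Union>K" for x using inj that by simp
  have neg_h: "- h x \<in> h ` \<Union>K" if "x \<in> \<Union>K" for x
  proof -
    have "h x \<in> ?S" using h(2) that by blast
    then show ?thesis unfolding h(2) by simp
  qed
  have ha: "h (a x) = - h x" and aK: "a x \<in> \<Union>K" if "x \<in> \<Union>K" for x
    unfolding a_def using neg_h[OF that] by (rule f_inv_into_f, rule inv_into_into)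
  interpret free_simplicial_involution K a
  proof
    show "simplicial_complex K" by (rule K)
    fix \<sigma> assume \<sigma>: "\<sigma> \<in> K"
    then obtain \<tau> where \<tau>: "\<tau> \<in> K" "uminus ` (h ` \<sigma>) = h ` \<tau>"
      using assms(1) by (auto simp: symmetric_triangulation_def)
    have "a ` \<sigma> = inv_into (\<Union>K) h ` uminus ` h ` \<sigma>" by (auto simp: a_def image_image)
    also have "\<dots> = \<tau>"
      unfolding \<tau>(2) using \<tau>(1) by (intro inv_into_image_cancel[OF inj]) auto
    finally show "a ` \<sigma> \<in> K" using \<tau>(1) by simp
    show "affine_map_on \<sigma> a"
      using assms(1) \<sigma> unfolding symmetric_triangulation_def a_def by blast
  next
    fix x assume x: "x \<in> \<Union>K"
    show "a (a x) = x" using ha[OF x] inv_h[OF x] by (simp add: a_def[of "a x"])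
    show "a x \<noteq> x"
    proof
      assume "a x = x"
      then have "2 *\<^sub>R h x = 0" using ha[OF x] unfolding scaleR_2 by (metis add.right_inverse)
      then have "h x = 0" by simp
      moreover have "h x \<in> ?S" using h(2) x by blast
      ultimately show False by simp
    qed
  qed
  have aff: "affine_map_on \<sigma> \<Lambda>" if "\<sigma> \<in> K" for \<sigma>
    unfolding \<Lambda>_def by (rule linear_extension_affine[OF T that])
  have odd: "\<Lambda> (a x) = - \<Lambda> x" if "x \<in> \<Union>K" for x
  proof -
    obtain \<sigma> where \<sigma>: "\<sigma> \<in> K" "x \<in> \<sigma>" using \<open>x \<in> \<Union>K\<close> by blast
    obtain C where C: "\<sigma> = convex hull C" "\<And>c. c \<in> C \<Longrightarrow> {c} \<in> K"
      by (rule simplicial_complex_simplex_cases[OF K \<sigma>(1)]) auto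
    \<comment> \<open>Both sides are affine on the simplex, and at its vertices they agree because
      the labelling is odd.\<close>
    have "- \<Lambda> (a x) = \<Lambda> x"
    proof (rule affine_map_on_convex_hull_eq[of C])
      show "affine_map_on (convex hull C) (\<lambda>x. - \<Lambda> (a x))"
        using affine_map_on_compose[OF affine[OF \<sigma>(1)] aff[OF simplex[OF \<sigma>(1)]]] C(1)
        by (auto intro: affine_map_on_uminus)
      show "affine_map_on (convex hull C) \<Lambda>" using aff \<sigma> C by auto
      show "x \<in> convex hull C" using \<sigma> C by simp
      fix c assume "c \<in> C"
      then have c: "{c} \<in> K" "{a c} \<in> K" using C simplex[of "{c}"] by auto
      then have "h c \<in> vertices_of K h" by (auto simp: vertices_of_def)
      then have "l (h (a c)) = - l (h c)"
        using assms(2) ha[OF UnionI[OF c(1)]] by (simp add: tucker_labelling_def)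
      then show "- \<Lambda> (a c) = \<Lambda> c" unfolding \<Lambda>_def using linear_extension_vertex[OF T] c by simp
    qed
    then show ?thesis by simp
  qed
  have finK: "finite K" using K by (simp add: simplicial_complex_def)
  have cont_simplex: "closed \<sigma>" "continuous_on \<sigma> \<Lambda>" if \<sigma>: "\<sigma> \<in> K" for \<sigma>
  proof -
    show "closed \<sigma>" using simplicial_complex_simplex_properties(2)[OF K \<sigma>] compact_imp_closed by blast
    obtain C where C: "\<not> affine_dependent C" "\<sigma> = convex hull C"
      by (rule simplicial_complex_simplex_cases[OF K \<sigma>])
    then show "continuous_on \<sigma> \<Lambda>" using affine_map_on_simplex_continuous aff[OF \<sigma>] by blast
  qed
  have cont\<Lambda>: "continuous_on (\<Union>K) \<Lambda>"
    using continuous_on_closed_Union[OF finK, of id \<Lambda>] cont_simplex by simp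
  define Z where "Z = {x \<in> \<Union>K. \<Lambda> x = 0}"
  have "a ` Z \<subseteq> Z"
  proof
    fix y assume "y \<in> a ` Z"
    then obtain x where "x \<in> \<Union>K" "\<Lambda> x = 0" "y = a x" by (auto simp: Z_def)
    then show "y \<in> Z" using odd[of x] aK[of x] by (simp add: Z_def)
  qed
  moreover have "\<exists>x\<in>Z. (x, a x) \<in> (adj K Z)\<^sup>*"
    unfolding Z_def using zero_set_joins_antipodes[OF _ hk ha cont\<Lambda> odd] by simp
  moreover have "Z \<subseteq> \<Union>K" by (auto simp: Z_def)
  ultimately obtain n q where nq: "2 \<le> n" "\<And>k. q (k + n) = a (q k)"
      "\<And>k. (q k, q (Suc k)) \<in> adj K Z"
      "\<And>i j. \<lbrakk>i \<le> j; j \<le> i + n; (q i, q j) \<in> adj K Z\<rbrakk> \<Longrightarrow> j \<le> Suc i"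
    using induced_antipodal_cycle[of Z] by metis
  interpret antipodal_cycle K a Z n q
    by unfold_locales (fact nq)+
  have convZ: "convex (Z \<inter> \<sigma>)" if "\<sigma> \<in> K" for \<sigma>
  proof -
    have "convex \<sigma>" using simplicial_complex_simplex_properties(1)[OF K that] .
    then show ?thesis
      unfolding convex_alt Z_def using affine_map_onD[OF aff[OF that]] that by auto
  qed
  \<comment> \<open>The full cycle has \<open>2 * n\<close> edges; scaling by \<open>N\<close> fits
    one turn into the unit interval.\<close>
  define N where "N = 2 * real n"
  have N: "0 < N" using n by (simp add: N_def)
  define g where "g s = h (loop (N * s))" for s
  have loopK: "loop (N * s) \<in> \<Union>K" "\<Lambda> (loop (N * s)) = 0" if "0 \<le> s" for s
    using loop_in_carrier[OF convZ, of "N * s"] that N by (auto simp: Z_def)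
  have range: "(*) N ` {0..1} = {0..N}" using N by (simp add: image_mult_atLeastAtMost)
  have "continuous_on {0..1} (\<lambda>s. loop (N * s))"
    using continuous_on_compose2[OF continuous_on_loop[of "2 * n"], of "{0..1}" "(*) N"] range
    by (auto intro!: continuous_intros simp: N_def)
  then have path: "path g"
    unfolding path_def g_def using loopK by (intro continuous_on_compose2[OF h(1)]) auto
  have "polygonal_path K h g"
    unfolding polygonal_path_def
  proof (intro conjI exI[of _ "2 * n"] exI[of _ "\<lambda>i. real i / N"] allI impI)
    fix i assume "i < 2 * n"
    show "real i / N < real (Suc i) / N" using N by (simp add: divide_strict_right_mono)
    let ?I = "{real i / N..real (Suc i) / N}"
    have scale: "N * s \<in> {real i..real (Suc i)}" "0 \<le> s" if "s \<in> ?I" for s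
    proof -
      show "N * s \<in> {real i..real (Suc i)}" using that N by (auto simp: field_simps)
      have "0 \<le> real i / N" using N by simp
      with that show "0 \<le> s" by auto
    qed
    obtain \<sigma> where \<sigma>: "\<sigma> \<in> K" "loop ` {real i..real (Suc i)} \<subseteq> Z \<inter> \<sigma>"
      using loop_in_common_simplex[OF convZ] by metis
    have "g ` ?I \<subseteq> h ` \<sigma>" using \<sigma>(2) scale by (fastforce simp: g_def)
    moreover have "affine_map_on ?I (\<lambda>s. inv_into (\<Union>K) h (g s))"
    proof -
      have aff_loop: "affine_map_on ?I (\<lambda>s. loop (N * s))"
        using scale by (intro affine_map_on_compose[OF _ loop_affine[of i]])
          (auto simp: affine_map_on_def algebra_simps)
      have eq: "inv_into (\<Union>K) h (g s) = loop (N * s)" if "s \<in> ?I" for s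
        unfolding g_def using inv_h loopK scale[OF that] by blast
      \<comment> \<open>\<open>eq\<close> holds only on the subinterval, so the convex combination
        has to be placed there before rewriting.\<close>
      have "(1 - u) *\<^sub>R x + u *\<^sub>R y \<in> ?I" if "x \<in> ?I" "y \<in> ?I" "u \<in> {0..1}" for x y u :: real
        using convex_real_interval(5)[of "real i / N" "real (Suc i) / N", unfolded convex_alt] that by auto
      with aff_loop eq show ?thesis unfolding affine_map_on_def by simp
    qed
    ultimately show "\<exists>\<sigma>\<in>K. g ` ?I \<subseteq> h ` \<sigma> \<and> affine_map_on ?I (\<lambda>s. inv_into (\<Union>K) h (g s))"
      using \<sigma>(1) by blast
  qed (use path n in \<open>auto simp: N_def\<close>)
  moreover have "simple_path g"
  proof -
    have *: "s = t \<or> s = 0 \<and> t = 1" if "0 \<le> s" "s \<le> t" "t \<le> 1" "g s = g t" for s t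
    proof -
      have "loop (N * s) = loop (N * t)"
        using inj_onD[OF inj, of "loop (N * s)" "loop (N * t)"] that loopK by (simp add: g_def)
      then show ?thesis
        using loop_eq_iff[of "N * s" "N * t"] that N by (auto simp: N_def)
    qed
    then have "loop_free g" unfolding loop_free_def
      by (metis atLeastAtMost_iff linear)
    with path show ?thesis by (simp add: simple_path_def)
  qed
  moreover have "pathfinish g = pathstart g"
    using loop_period[of 0] by (simp add: pathfinish_def pathstart_def g_def N_def)
  moreover have "path_image g \<subseteq> ?S"
    using h(2) loopK by (fastforce simp: path_image_def g_def)
  moreover have "uminus ` path_image g = path_image g"
  proof -
    have neg: "- g s \<in> path_image g" if s: "s \<in> {0..1}" for s
    proof -
      have Ns: "0 \<le> N * s" using s N by simp
      have gs: "- g s = h (loop (N * s + real n))"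
        using ha[OF loopK(1)] loop_antipode[OF Ns] s by (simp add: g_def)
      \<comment> \<open>The antipode is half a turn away; shifting forwards or backwards by 1/2
        keeps the parameter in the unit interval.\<close>
      have half: "N * (s + 1/2) = N * s + real n" "N * (s - 1/2) = N * s - real n"
        by (simp_all add: N_def algebra_simps)
      show ?thesis
      proof (cases "s \<le> 1/2")
        case True
        then have "- g s = g (s + 1/2)" using gs half by (simp add: g_def)
        then show ?thesis using True s by (auto simp: path_image_def)
      next
        case False
        then have "0 \<le> N * (s - 1/2)" using N by simp
        then have "- g s = g (s - 1/2)"
          using gs half(2) loop_period[of "N * (s - 1/2)"] by (simp add: g_def add.commute)
        then show ?thesis using False s by (auto simp: path_image_def)
      qed
    qed
    then have "uminus ` path_image g \<subseteq> path_image g" by (auto simp: path_image_def)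
    moreover from this have "x \<in> uminus ` path_image g" if "x \<in> path_image g" for x
      using that by (metis image_eqI image_subset_iff minus_minus)
    ultimately show ?thesis by blast
  qed
  moreover have "\<forall>x\<in>path_image g. linear_extension K h l x = 0"
    using loopK(2) by (auto simp: path_image_def g_def \<Lambda>_def)
  ultimately show ?thesis by blast
qed

end
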